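(* Let $\mathscr A$ be the set of unconditional affects relations arising from a causal model over a set $S$ of observed random variables, and suppose the causal model does not yield any affects relation satisfying Clus$_3$. Let $\mathscr A'\subseteq\mathscr A$ consist of all affects relations in $\mathscr A$ that are both Irred$_1$ and Irred$_3$. Then for any embedding $\mathcal E$ of $S$ in any space-time (poset) $\mathcal T$ such that $\mathscr A$ is compatible with $\mathcal E$, $$(X\vDash Y\mid\mathrm{do}(Z))\in\mathscr A'\quad\Longrightarrow\quad \bar{\mathcal F}_s(\mathcal Y)\subseteq\bar{\mathcal F}_s(\mathcal X)\cap\bar{\mathcal F}_s(\mathcal Z).$$
   Context: **Causal model.** A causal structure is a directed graph $\mathcal G$ (cycles allowed) whose nodes are observed or unobserved; the finitely many observed nodes $S$ are random variables. For sets, $AB:=A\cup B$. For $I\subseteq S$, $\mathcal G_{\mathrm{do}(I)}$ is $\mathcal G$ with all edges into $I$ removed ($\mathcal G_{\mathrm{do}(\emptyset)}=\mathcal G$). A causal model consists of $\mathcal G$ and, for each $I\subseteq S$, a distribution $P_{\mathcal G_{\mathrm{do}(I)}}$ over $S$ satisfying the d-separation property relative to $\mathcal G_{\mathrm{do}(I)}$ (d-separation of disjoint sets of observed nodes in the graph implies the corresponding conditional independence). Conditional distributions given values of the intervened nodes are taken as specified for all such values. **Affects relations.** For pairwise disjoint $X,Y,Z\subset S$, $X,Y$ non-empty, $X\vDash Y\mid\mathrm{do}(Z)$ holds iff there are values $x,z$ with $P_{\mathcal G_{\mathrm{do}(XZ)}}(Y|X=x,Z=z)\ne P_{\mathcal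 G_{\mathrm{do}(Z)}}(Y|Z=z)$; $\not\vDash$ is the negation. $\mathscr A$ is the set of all such relations holding in the model. - $X\vDash Y\mid\mathrm{do}(Z)$ is Red$_1$ if there is a non-empty $s_X\subsetneq X$ with $s_X\not\vDash Y\mid\mathrm{do}((X\setminus s_X)Z)$; Irred$_1$ means not Red$_1$. - It is Red$_3$ if there is a non-empty $s_Z\subseteq Z$ such that, with $\tilde s_Z=Z\setminus s_Z$, both $s_Z\not\vDash Y\mid\mathrm{do}(X\tilde s_Z)$ and $s_Z\not\vDash Y\mid\mathrm{do}(\tilde s_Z)$; Irred$_3$ means not Red$_3$. - It is Clus$_3$ if $|Z|\ge1$ and no $s_Z\subsetneq Z$ (possibly empty) satisfies $X\vDash Y\mid\mathrm{do}(s_Z)$. **Space-time embedding.** A space-time is a poset $\mathcal T$; $\bar J^+(x)=\{b\in\mathcal T:b\succeq x\}$. An embedding $\mathcal E$ of $S$ in $\mathcal T$ is given by a map $O:S\to\mathcal T$. For $X\subseteq S$, $\mathcal X$ denotes the corresponding set of ordered random variables $(e,O(e))$, $e\in X$, and $\bar{\mathcal F}_s(\mathcal X):=\bigcap_{e\in X}\bar J^+(O(e))$, with $\bar{\mathcal F}_s(\emptyset)=\mathcal T$. **Compatibility.** $\mathscr A$ is compatible with $\mathcal E$ if for every $(X\vDash Y\mid\mathrm{do}(Z))\in\mathscr A$ that is Irred$_1$, $\bar{\mathcal F}_s(\mathcal Y)\cap\bar{\mathcal F}_s(\mathcal Z)\subseteq\bar{\mathcal F}_s(\mathcal X)$. 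*)

theory Defs
  imports "HOL-Probability.Probability" "Graph_Theory.Pair_Digraph"
begin

section \<open>Causal structures and d-separation\<close>

definition do_graph :: "'v pair_pre_digraph \<Rightarrow> 'v set \<Rightarrow> 'v pair_pre_digraph" where
  "do_graph G I = G\<lparr>parcs := {a \<in> parcs G. snd a \<notin> I}\<rparr>"

text \<open>
  A path is a sequence \<open>vs\<close> of distinct nodes with a list \<open>ds\<close> of directions: \<open>ds ! i\<close> states
  that the \<open>i\<close>-th step follows an arc forwards, \<open>\<not> ds ! i\<close> that it traverses an arc backwards.
  The directions have to be recorded because a cyclic graph may contain both \<open>(u, v)\<close> and
  \<open>(v, u)\<close>, which give different paths.
\<close>

definition is_path :: "'v pair_pre_digraph \<Rightarrow> 'v \<Rightarrow> 'v list \<Rightarrow> bool list \<Rightarrow> 'v \<Rightarrow> bool" where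
  "is_path G x vs ds y \<longleftrightarrow>
     length vs = Suc (length ds) \<and> hd vs = x \<and> last vs = y \<and>
     distinct vs \<and> set vs \<subseteq> pverts G \<and>
     (\<forall>i < length ds. if ds ! i then (vs ! i, vs ! Suc i) \<in> parcs G
                      else (vs ! Suc i, vs ! i) \<in> parcs G)"

text \<open>
  An inner node \<open>vs ! Suc i\<close> is a collider if it is entered forwards and left backwards.
  Reachability is reflexive, so it covers the collider itself and all of its descendants.
\<close>

definition blocked :: "'v pair_pre_digraph \<Rightarrow> 'v set \<Rightarrow> 'v list \<Rightarrow> bool list \<Rightarrow> bool" where
  "blocked G W vs ds \<longleftrightarrow>
     (\<exists>i. Suc i < length ds \<and>
        (if ds ! i \<and> \<not> ds ! Suc i
         then \<forall>d. vs ! Suc i \<rightarrow>\<^sup>*\<^bsub>with_proj G\<^esub> d \<longrightarrow> d \<notin> W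
         else vs ! Suc i \<in> W))"

definition d_separated ::
    "'v pair_pre_digraph \<Rightarrow> 'v set \<Rightarrow> 'v set \<Rightarrow> 'v set \<Rightarrow> bool" where
  "d_separated G X Y W \<longleftrightarrow>
     (\<forall>x\<in>X. \<forall>y\<in>Y. \<forall>vs ds. is_path G x vs ds y \<longrightarrow> blocked G W vs ds)"

section \<open>Causal models\<close>

text \<open>
  \<open>M e\<close> is the measurable space of values of the observed variable \<open>e\<close> (a \<open>count_space\<close> for a
  discrete variable), so joint values of \<open>X\<close> are the points of \<open>PiM X M\<close>.
\<close>

definition var_algebra ::
    "'v set \<Rightarrow> ('v \<Rightarrow> 'a measure) \<Rightarrow> 'v set \<Rightarrow> ('v \<Rightarrow> 'a) measure" where
  "var_algebra S M W =
     vimage_algebra (space (PiM S M)) (\<lambda>\<omega>. restrict \<omega> W) (PiM W M)"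

text \<open>
  Independence of \<open>X\<close> and \<open>Y\<close> given \<open>W\<close>: the product rule for conditional probabilities
  given the sigma-algebra generated by \<open>W\<close>.
\<close>

definition cond_indep_given ::
    "'v set \<Rightarrow> ('v \<Rightarrow> 'a measure) \<Rightarrow> ('v \<Rightarrow> 'a) measure \<Rightarrow> 'v set \<Rightarrow> 'v set \<Rightarrow> 'v set \<Rightarrow> bool" where
  "cond_indep_given S M Q X Y W \<longleftrightarrow>
     (\<forall>A \<in> sets (var_algebra S M X). \<forall>B \<in> sets (var_algebra S M Y).
        AE \<omega> in Q.
          real_cond_exp Q (var_algebra S M W) (indicator (A \<inter> B)) \<omega> =
          real_cond_exp Q (var_algebra S M W) (indicator A) \<omega> *
          real_cond_exp Q (var_algebra S M W) (indicator B) \<omega>)"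

text \<open>
  \<open>S\<close> is the set of observed nodes, \<open>P I\<close> is the distribution over \<open>S\<close> belonging to
  \<open>do_graph G I\<close>, and \<open>K I v\<close> is its conditional distribution given that the
  intervened nodes \<open>I\<close> have the values \<open>v\<close>. A conditional distribution is determined by
  \<open>P I\<close> only up to null sets; as it has to be available for all values \<open>v\<close>, it is part of the model:
  \<open>K I\<close> is a regular conditional distribution of \<open>P I\<close> given \<open>I\<close>.
\<close>

locale causal_model = pair_wf_digraph G for G :: "'v pair_pre_digraph" +
  fixes S :: "'v set"
    and M :: "'v \<Rightarrow> 'a measure"
    and P :: "'v set \<Rightarrow> ('v \<Rightarrow> 'a) measure"
    and K :: "'v set \<Rightarrow> ('v \<Rightarrow> 'a) \<Rightarrow> ('v \<Rightarrow> 'a) measure"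
  assumes finite_observed: "finite S"
    and observed_nodes: "S \<subseteq> pverts G"
    and distribution: "\<And>I. I \<subseteq> S \<Longrightarrow> P I \<in> space (prob_algebra (PiM S M))"
    and d_separation_property:
      "\<And>I X Y W. \<lbrakk>I \<subseteq> S; X \<subseteq> S; Y \<subseteq> S; W \<subseteq> S; X \<inter> Y = {}; X \<inter> W = {}; Y \<inter> W = {};
         d_separated (do_graph G I) X Y W\<rbrakk> \<Longrightarrow> cond_indep_given S M (P I) X Y W"
    and kernel: "\<And>I. I \<subseteq> S \<Longrightarrow> K I \<in> PiM I M \<rightarrow>\<^sub>M prob_algebra (PiM S M)"
    and kernel_values: "\<And>I v. \<lbrakk>I \<subseteq> S; v \<in> space (PiM I M)\<rbrakk> \<Longrightarrow>
      distr (K I v) (PiM I M) (\<lambda>\<omega>. restrict \<omega> I) = return (PiM I M) v"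
    and disintegration: "\<And>I. I \<subseteq> S \<Longrightarrow>
      P I = distr (P I) (PiM I M) (\<lambda>\<omega>. restrict \<omega> I) \<bind> K I"

section \<open>Affects relations\<close>

text \<open>The relation \<open>X \<Turnstile> Y | do(Z)\<close> is encoded as the triple \<open>(X, Y, Z)\<close>.\<close>

type_synonym 'v affects_rel = "'v set \<times> 'v set \<times> 'v set"

definition cond_marginal ::
    "('v \<Rightarrow> 'a measure) \<Rightarrow> ('v set \<Rightarrow> ('v \<Rightarrow> 'a) \<Rightarrow> ('v \<Rightarrow> 'a) measure) \<Rightarrow>
     'v set \<Rightarrow> ('v \<Rightarrow> 'a) \<Rightarrow> 'v set \<Rightarrow> ('v \<Rightarrow> 'a) measure" where
  "cond_marginal M K I v Y = distr (K I v) (PiM Y M) (\<lambda>\<omega>. restrict \<omega> Y)"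

definition affects ::
    "'v set \<Rightarrow> ('v \<Rightarrow> 'a measure) \<Rightarrow> ('v set \<Rightarrow> ('v \<Rightarrow> 'a) \<Rightarrow> ('v \<Rightarrow> 'a) measure) \<Rightarrow>
     'v set \<Rightarrow> 'v set \<Rightarrow> 'v set \<Rightarrow> bool" where
  "affects S M K X Y Z \<longleftrightarrow>
     X \<subseteq> S \<and> Y \<subseteq> S \<and> Z \<subseteq> S \<and> X \<inter> Y = {} \<and> X \<inter> Z = {} \<and> Y \<inter> Z = {} \<and>
     X \<noteq> {} \<and> Y \<noteq> {} \<and>
     (\<exists>x \<in> space (PiM X M). \<exists>z \<in> space (PiM Z M).
        cond_marginal M K (X \<union> Z) (merge X Z (x, z)) Y \<noteq> cond_marginal M K Z z Y)"

definition affects_relations ::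
    "'v set \<Rightarrow> ('v \<Rightarrow> 'a measure) \<Rightarrow> ('v set \<Rightarrow> ('v \<Rightarrow> 'a) \<Rightarrow> ('v \<Rightarrow> 'a) measure) \<Rightarrow>
     'v affects_rel set" where
  "affects_relations S M K = {(X, Y, Z). affects S M K X Y Z}"

text \<open>
  The following notions only depend on the set \<open>A\<close> of affects relations that hold. They are
  meant for \<open>(X, Y, Z) \<in> A\<close>; then all triples below are disjoint subsets of \<open>S\<close>, so non-membership
  in \<open>A\<close> says exactly that the relation in question does not hold.
\<close>

definition red1 :: "'v affects_rel set \<Rightarrow> 'v affects_rel \<Rightarrow> bool" where
  "red1 A = (\<lambda>(X, Y, Z). \<exists>s. s \<noteq> {} \<and> s \<subset> X \<and> (s, Y, (X - s) \<union> Z) \<notin> A)"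

abbreviation irred1 :: "'v affects_rel set \<Rightarrow> 'v affects_rel \<Rightarrow> bool" where
  "irred1 A r \<equiv> \<not> red1 A r"

definition red3 :: "'v affects_rel set \<Rightarrow> 'v affects_rel \<Rightarrow> bool" where
  "red3 A = (\<lambda>(X, Y, Z). \<exists>s. s \<noteq> {} \<and> s \<subseteq> Z \<and>
     (s, Y, X \<union> (Z - s)) \<notin> A \<and> (s, Y, Z - s) \<notin> A)"

abbreviation irred3 :: "'v affects_rel set \<Rightarrow> 'v affects_rel \<Rightarrow> bool" where
  "irred3 A r \<equiv> \<not> red3 A r"

definition clus3 :: "'v affects_rel set \<Rightarrow> 'v affects_rel \<Rightarrow> bool" where
  "clus3 A = (\<lambda>(X, Y, Z). card Z \<ge> 1 \<and> \<not> (\<exists>s. s \<subset> Z \<and> (X, Y, s) \<in> A))"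

section \<open>Space-time embeddings\<close>

text \<open>
  The space-time is the partially ordered type \<open>'p\<close>, and an embedding is given by the locations
  \<open>loc e\<close> of the nodes \<open>e \<in> S\<close>; its values outside \<open>S\<close> are never used. For \<open>X = {}\<close> the joint
  future is \<open>UNIV\<close>.
\<close>

definition future :: "'p::order \<Rightarrow> 'p set" where
  "future p = {b. b \<ge> p}"

definition joint_future :: "('v \<Rightarrow> 'p::order) \<Rightarrow> 'v set \<Rightarrow> 'p set" where
  "joint_future loc X = (\<Inter>e\<in>X. future (loc e))"

definition compatible :: "'v affects_rel set \<Rightarrow> ('v \<Rightarrow> 'p::order) \<Rightarrow> bool" where
  "compatible A loc \<longleftrightarrow>
     (\<forall>X Y Z. (X, Y, Z) \<in> A \<longrightarrow> irred1 A (X, Y, Z) \<longrightarrow>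
        joint_future loc Y \<inter> joint_future loc Z \<subseteq> joint_future loc X)"

end

theory Submission
  imports Defs
begin

text \<open>
  Relations with a singleton cause are trivially irreducible in their first argument. By
  irreducibility every single \<open>e \<in> X \<union> Z\<close> affects \<open>Y\<close> under some intervention, and without
  \<open>Clus\<^sub>3\<close> relations this intervention can be shrunk to the empty one. Compatibility with
  \<open>{e} \<Turnstile> Y | do({})\<close> then puts the joint future of \<open>Y\<close> inside the future of \<open>e\<close>.
\<close>

text \<open>A relation with \<open>Z\<close> non-empty that is not \<open>clus3\<close> persists for
  some strictly smaller intervention set, so descent on the finite \<open>Z\<close> stops only at
  \<open>{}\<close>.\<close>

lemma no_clus3_imp_affects_empty:
  assumes no_clus3: "\<And>r. r \<in> A \<Longrightarrow> \<not> clus3 A r"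
    and "finite Z" and "(X, Y, Z) \<in> A"
  shows "(X, Y, {}) \<in> A"
  using assms(2,3)
proof (induction Z rule: finite_psubset_induct)
  case (psubset Z)
  show ?case
  proof (cases "Z = {}")
    case False
    with psubset.hyps have "card Z \<ge> 1"
      by (simp add: Suc_le_eq card_gt_0_iff)
    with no_clus3[OF psubset.prems] obtain s where "s \<subset> Z" "(X, Y, s) \<in> A"
      by (auto simp: clus3_def)
    then show ?thesis
      by (rule psubset.IH)
  qed (use psubset.prems in simp)
qed

lemma irred1_singleton: "irred1 A ({e}, Y, Z)"
  by (auto simp: red1_def)

text \<open>Take \<open>s = {e}\<close> in \<open>red1\<close>. This needs \<open>{e}\<close> to be
  a proper subset; if \<open>X = {e}\<close>, the claim is the given relation itself.\<close>

lemma irred1_imp_singleton_affects: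
  assumes "(X, Y, Z) \<in> A" "irred1 A (X, Y, Z)" "e \<in> X"
  shows "({e}, Y, (X - {e}) \<union> Z) \<in> A"
proof (cases "X = {e}")
  case False
  with \<open>e \<in> X\<close> have "{e} \<subset> X"
    by blast
  with assms(2) show ?thesis
    unfolding red1_def by blast
qed (use assms(1) in simp)

text \<open>Take \<open>s = {e}\<close> in \<open>red3\<close>. Which disjunct holds is immaterial,
  since either intervention set can later be shrunk to \<open>{}\<close>.\<close>

lemma irred3_imp_singleton_affects:
  assumes "irred3 A (X, Y, Z)" "e \<in> Z"
  shows "({e}, Y, X \<union> (Z - {e})) \<in> A \<or> ({e}, Y, Z - {e}) \<in> A"
  using assms unfolding red3_def by blast

lemma joint_future_subset_singleton:
  assumes "\<And>r. r \<in> A \<Longrightarrow> \<not> clus3 A r" "compatible A loc" "finite Z" "({e}, Y, Z) \<in> A"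
  shows "joint_future loc Y \<subseteq> future (loc e)"
proof -
  have "({e}, Y, {}) \<in> A"
    using assms(1,3,4) by (rule no_clus3_imp_affects_empty)
  then have "joint_future loc Y \<inter> joint_future loc {} \<subseteq> joint_future loc {e}"
    using assms(2) irred1_singleton unfolding compatible_def by metis
  \<comment> \<open>\<open>joint_future loc {}\<close> is an empty intersection, hence
    \<open>UNIV\<close>.\<close>
  then show ?thesis
    by (simp add: joint_future_def)
qed

theorem theorem6p4:
  fixes G :: "'v pair_pre_digraph"
    and S :: "'v set"
    and M :: "'v \<Rightarrow> 'a measure"
    and P :: "'v set \<Rightarrow> ('v \<Rightarrow> 'a) measure"
    and K :: "'v set \<Rightarrow> ('v \<Rightarrow> 'a) \<Rightarrow> ('v \<Rightarrow> 'a) measure"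
    and A A' :: "'v affects_rel set"
    and loc :: "'v \<Rightarrow> 'p::order"
    and X Y Z :: "'v set"
  assumes "causal_model G S M P K"
    and "A = affects_relations S M K"
    and "\<not> (\<exists>r \<in> A. clus3 A r)"
    and "A' = {r \<in> A. irred1 A r \<and> irred3 A r}"
    and "compatible A loc"
    and "(X, Y, Z) \<in> A'"
  shows "joint_future loc Y \<subseteq> joint_future loc X \<inter> joint_future loc Z"
proof -
  have fin: "finite W" if "(U, V, W) \<in> A" for U V W
  proof (rule finite_subset)
    show "W \<subseteq> S"
      using that by (simp add: assms(2) affects_relations_def affects_def)
    show "finite S"
      using assms(1) by (rule causal_model.finite_observed)
  qed
  \<comment> \<open>\<open>W\<close> stays arbitrary so that the sets arising from \<open>X\<close>
    and from both cases for \<open>Z\<close> are all covered.\<close>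
  have key: "joint_future loc Y \<subseteq> future (loc e)" if "({e}, Y, W) \<in> A" for e W
    using assms(3) by (intro joint_future_subset_singleton[OF _ assms(5) fin[OF that] that]) blast
  have rel: "(X, Y, Z) \<in> A" and irred1: "irred1 A (X, Y, Z)" and irred3: "irred3 A (X, Y, Z)"
    using assms(4,6) by auto
  have "joint_future loc Y \<subseteq> future (loc e)" if "e \<in> X" for e
    using irred1_imp_singleton_affects[OF rel irred1 that] by (rule key)
  moreover have "joint_future loc Y \<subseteq> future (loc e)" if "e \<in> Z" for e
    using irred3_imp_singleton_affects[OF irred3 that] key by blast
  ultimately show ?thesis
    unfolding joint_future_def[of loc X] joint_future_def[of loc Z] by blast
qed

end
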